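(* Let $A, X \in \mathbb{C}^{m \times n}$ and $W \in \mathbb{C}^{n \times m}$. Then the following statements are equivalent. (i) $X \in A\{1',2',3'\}$. (ii) $r(WAW)=r(A)$, $XWAWX=X$, and $\mathcal{N}(X)=\mathcal{N}((WA)^* )$. (iii) $r(WAW)=r(A)$, $AWXWA=A$, and $\mathcal{N}(X)=\mathcal{N}((WA)^* )$.
   Context: $r(\cdot)$ denotes rank, $\mathcal{N}(\cdot)$ null space, $*$ conjugate transpose. For $A \in \mathbb{C}^{m \times n}$, $W \in \mathbb{C}^{n \times m}$, $A\{1',2',3'\}$ is the set of all $X \in \mathbb{C}^{m \times n}$ with $AWXWA=A$, $XWAWX=X$ and $(WAWX)^*=WAWX$. *)

theory Defs
  imports "HOL-Analysis.Analysis"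
begin

(* An m x n complex matrix has type complex^'n^'m. The library's rank is the row rank over the
   scalar field, here the complex numbers. *)

definition conj_transpose :: "complex^'n^'m \<Rightarrow> complex^'m^'n" where
  "conj_transpose M = map_matrix cnj (transpose M)"

definition null_space :: "complex^'n^'m \<Rightarrow> (complex^'n) set" where
  "null_space M = {v. M *v v = 0}"

(* The set A{1',2',3'}; the weight W, implicit in that notation, is an explicit argument. *)
definition weighted_inverses_123 ::
    "complex^'m^'n \<Rightarrow> complex^'n^'m \<Rightarrow> (complex^'n^'m) set" where
  "weighted_inverses_123 W A =
    {X. A ** W ** X ** W ** A = A
      \<and> X ** W ** A ** W ** X = X
      \<and> conj_transpose (W ** A ** W ** X) = W ** A ** W ** X}"

end

(* Put E = WAWX. If XWAWX = X and N(X) is contained in N((WA)^* ), then X(I - E) = 0 gives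
   (WA)^* = (WA)^* E, so E^* = (WX)^* (WA)^* = (WX)^* (WA)^* E = E^* E: hence E is Hermitian and
   E WA = WA, where W can be cancelled on the left because r(WA) = r(A).
   If AWXWA = A and N(X) = N((WA)^* ), then r(XWA) >= r(A) >= r(WA) = r(X), so the columns of X lie in the column
   space of XWA, on which XWAW acts as the identity. *)
theory Submission
  imports Defs
begin

section \<open>Rank, null spaces and matrix factorizations\<close>

text \<open>The rank is a row rank. With the row space as the range of a linear map, comparing row
  spaces turns into factoring one matrix through another.\<close>

lemma span_rows_eq_range:
  fixes A :: "'a::field^'n^'m"
  shows "vec.span (rows A) = range (\<lambda>x. x v* A)"
proof
  have "row i A = axis i 1 v* A" for i
    by (simp add: row_def vector_matrix_mult_def axis_def vec_eq_iff if_distrib if_distribR cong: if_cong)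
  moreover have "vec.subspace (range ((*v) (transpose A)))"
    by (intro vec.linear_subspace_image matrix_vector_mul_linear_gen vec.subspace_UNIV)
  ultimately show "vec.span (rows A) \<subseteq> range (\<lambda>x. x v* A)"
    by (intro vec.span_minimal) (auto simp: rows_def)
  show "range (\<lambda>x. x v* A) \<subseteq> vec.span (rows A)"
    using matrix_vector_mult_in_columnspace_gen[of "transpose A"]
    by auto
qed

lemma rank_eq_dim_range:
  fixes A :: "'a::field^'n^'m"
  shows "rank A = vec.dim (range (\<lambda>x. x v* A))"
  by (simp add: row_rank_def_gen flip: span_rows_eq_range)

lemma range_vector_matrix_mul_subset:
  fixes P :: "'a::field^'n^'m" and Q :: "'a^'k^'n"
  shows "range (\<lambda>x. x v* (P ** Q)) \<subseteq> range (\<lambda>x. x v* Q)"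
  by (auto simp flip: vector_matrix_mul_assoc)

lemma rank_mul_le_right_field:
  fixes P :: "'a::field^'n^'m" and Q :: "'a^'k^'n"
  shows "rank (P ** Q) \<le> rank Q"
  by (simp add: rank_eq_dim_range vec.dim_subset range_vector_matrix_mul_subset)

text \<open>The row space of PQ is the image of the row space of P under the linear map given by
  \<open>transpose Q\<close>, and a linear image has no larger dimension.\<close>

lemma rank_mul_le_left_field:
  fixes P :: "'a::field^'n^'m" and Q :: "'a^'k^'n"
  shows "rank (P ** Q) \<le> rank P"
proof -
  have "range (\<lambda>x. x v* (P ** Q)) = (*v) (transpose Q) ` range (\<lambda>x. x v* P)"
    by (auto simp: image_comp o_def simp flip: vector_matrix_mul_assoc)
  then show ?thesis
    by (simp only: rank_eq_dim_range vec.dim_image_le matrix_vector_mul_linear_gen)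
qed

text \<open>The row space of PQ lies in that of Q, so equal dimensions make them equal. Every row of
  Q is then a combination of rows of PQ. This is what lets P be cancelled on the left.\<close>

lemma matrix_left_factor_if_rank_eq:
  fixes P :: "'a::field^'n^'m" and Q :: "'a^'k^'n"
  assumes "rank (P ** Q) = rank Q"
  obtains Z where "Q = Z ** (P ** Q)"
proof -
  have "range (\<lambda>x. x v* (P ** Q)) = range (\<lambda>x. x v* Q)"
  proof (rule vec.subspace_dim_equal)
    show "vec.dim (range (\<lambda>x. x v* Q)) \<le> vec.dim (range (\<lambda>x. x v* (P ** Q)))"
      using assms by (simp add: rank_eq_dim_range)
    show "range (\<lambda>x. x v* (P ** Q)) \<subseteq> range (\<lambda>x. x v* Q)"
      by (rule range_vector_matrix_mul_subset)
  qed (simp_all flip: span_rows_eq_range)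
  then have "\<exists>y. x v* Q = y v* (P ** Q)" for x
    by blast
  then obtain f where f: "\<And>x. x v* Q = f x v* (P ** Q)"
    by metis
  \<comment> \<open>Row i of Q is \<open>axis i 1 v* Q\<close>, so \<open>f (axis i 1)\<close> holds
    its coefficients with respect to the rows of PQ.\<close>
  define Z where "Z = (\<chi> i. f (axis i 1))"
  have "axis i 1 v* M = M $ i" for i and M :: "'a^'k^'n"
    by (simp add: vector_matrix_mult_def axis_def vec_eq_iff if_distrib if_distribR cong: if_cong)
  then have "Q $ i = Z $ i v* (P ** Q)" for i
    using f[of "axis i 1"] by (simp add: Z_def)
  moreover have "(Z ** M) $ i = Z $ i v* M" for i and M :: "'a^'k^'m"
    by (simp add: vec_eq_iff matrix_matrix_mult_def vector_matrix_mult_def)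
  ultimately have "Q = Z ** (P ** Q)"
    by (metis vec_eq_iff)
  then show thesis by (rule that)
qed

text \<open>G is the matrix of a linear map that picks a preimage under P for each vector in the
  range of P.\<close>

lemma ex_generalized_inverse:
  fixes P :: "'a::field^'n^'m"
  obtains G where "P ** G ** P = P"
proof -
  obtain g where "Vector_Spaces.linear (*s) (*s) g" "\<forall>v\<in>range ((*v) P). P *v g v = v"
    using vec.linear_exists_right_inverse_on[OF matrix_vector_mul_linear_gen vec.subspace_UNIV]
    by blast
  then have "P ** matrix g ** P = P"
    by (simp add: matrix_eq matrix_works flip: matrix_vector_mul_assoc)
  then show thesis by (rule that)
qed

text \<open>For a generalized inverse G of P, the vector x - GPx is killed by P, hence by Q. So Q =
  QGP, and QG is the factor.\<close>

lemma matrix_left_factor_if_null_space_subset: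
  assumes "null_space P \<subseteq> null_space Q"
  obtains Z where "Q = Z ** P"
proof -
  obtain G where G: "P ** G ** P = P"
    by (rule ex_generalized_inverse)
  have "Q *v x = (Q ** G ** P) *v x" for x
  proof -
    have "x - (G ** P) *v x \<in> null_space P"
      by (simp add: null_space_def matrix_vector_mult_diff_distrib matrix_vector_mul_assoc
        matrix_mul_assoc G)
    with assms have "Q *v (x - (G ** P) *v x) = 0"
      by (auto simp: null_space_def)
    then show ?thesis
      by (simp add: matrix_vector_mult_diff_distrib matrix_vector_mul_assoc matrix_mul_assoc)
  qed
  then show thesis
    by (intro that[of "Q ** G"]) (simp add: matrix_eq)
qed

lemma null_space_matrix_mul: "null_space Q \<subseteq> null_space (P ** Q)"
  by (auto simp: null_space_def simp flip: matrix_vector_mul_assoc)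

text \<open>Each matrix is a left multiple of the other, and left multiplication cannot raise the
  rank.\<close>

lemma rank_eq_if_null_space_eq:
  assumes "null_space P = null_space Q"
  shows "rank P = rank Q"
proof -
  obtain Y Z where "Q = Y ** P" and "P = Z ** Q"
    using assms by (metis matrix_left_factor_if_null_space_subset subset_refl)
  then show ?thesis
    using rank_mul_le_right_field[of Y P] rank_mul_le_right_field[of Z Q] by simp
qed

section \<open>Conjugate transposes\<close>

lemma conj_transpose_conj_transpose [simp]: "conj_transpose (conj_transpose M) = M"
  by (simp add: conj_transpose_def transpose_def vec_eq_iff)

lemma conj_transpose_mul: "conj_transpose (P ** Q) = conj_transpose Q ** conj_transpose P"
  by (simp add: conj_transpose_def transpose_def vec_eq_iff matrix_matrix_mult_def mult.commute)

lemma null_space_conj_transpose_mul_self: "null_space (conj_transpose M ** M) = null_space M"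
proof
  show "null_space (conj_transpose M ** M) \<subseteq> null_space M"
  proof
    fix x assume "x \<in> null_space (conj_transpose M ** M)"
    then have 0: "conj_transpose M *v (M *v x) = 0"
      by (simp add: null_space_def matrix_vector_mul_assoc)
    define y where "y = M *v x"
    \<comment> \<open>For y = Mx, the squared norm of y is the inner product of x with M^* y, which
      is zero by assumption.\<close>
    have "complex_of_real (\<Sum>i\<in>UNIV. (cmod (y $ i))\<^sup>2) =
        (\<Sum>i\<in>UNIV. (\<Sum>j\<in>UNIV. cnj (M $ i $ j) * cnj (x $ j)) * y $ i)"
      by (simp add: complex_norm_square y_def matrix_vector_mult_def mult.commute del: of_real_power)
    also have "\<dots> = (\<Sum>j\<in>UNIV. cnj (x $ j) * (conj_transpose M *v y) $ j)"
      unfolding matrix_vector_mult_def conj_transpose_def transpose_def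
      by (simp add: sum_distrib_left sum_distrib_right mult_ac)
        (rule sum.swap)
    finally have "(\<Sum>i\<in>UNIV. (cmod (y $ i))\<^sup>2) = 0"
      using 0 by (simp add: y_def del: of_real_sum)
    then show "x \<in> null_space M"
      by (simp add: sum_nonneg_eq_0_iff y_def null_space_def vec_eq_iff)
  qed
qed (rule null_space_matrix_mul)

text \<open>N and N^* N have the same null space, hence the same rank, so the rank of N is at most
  that of N^*. Applying this to both M and M^* gives equality.\<close>

lemma rank_conj_transpose [simp]: "rank (conj_transpose M) = rank M"
proof -
  have "rank N \<le> rank (conj_transpose N)" for N :: "complex^'k^'l"
    using rank_eq_if_null_space_eq[OF null_space_conj_transpose_mul_self[of N]]
      rank_mul_le_left_field[of "conj_transpose N" N] by simp
  from this[of M] this[of "conj_transpose M"] show ?thesis by simp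
qed

lemma matrix_right_factor_if_rank_eq:
  fixes P :: "complex^'n^'m" and Q :: "complex^'k^'n"
  assumes "rank (P ** Q) = rank P"
  obtains Y where "P = P ** Q ** Y"
proof -
  have "rank (conj_transpose Q ** conj_transpose P) = rank (conj_transpose P)"
    using assms by (simp flip: conj_transpose_mul)
  then obtain Z where "conj_transpose P = Z ** (conj_transpose Q ** conj_transpose P)"
    by (rule matrix_left_factor_if_rank_eq)
  then have "P = P ** Q ** conj_transpose Z"
    by (metis conj_transpose_mul conj_transpose_conj_transpose)
  then show thesis by (rule that)
qed

section \<open>Characterizations of the weighted inverses\<close>

text \<open>For the null spaces, X and (WA)^* are shown to be left multiples of each other. With E =
  WAWX Hermitian, E WA = WA gives (WA)^* = (WA)^* E, which ends in X, while X = XE = X E^* ends in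
  (WA)^*.\<close>

lemma weighted_inverse_123_imp:
  fixes A X :: "complex^'n^'m" and W :: "complex^'m^'n"
  assumes "X \<in> weighted_inverses_123 W A"
  shows "rank (W ** A ** W) = rank A" and "null_space X = null_space (conj_transpose (W ** A))"
proof -
  define E where "E = W ** A ** W ** X"
  have 1: "A ** W ** X ** W ** A = A" and 2: "X ** W ** A ** W ** X = X"
    and 3: "conj_transpose E = E"
    using assms by (auto simp: weighted_inverses_123_def E_def)
  \<comment> \<open>Using the inner equation twice exhibits WAW as a factor of A, which bounds the
    rank of A.\<close>
  have "A = A ** W ** X ** (W ** A ** W) ** (X ** W ** A)"
    by (simp add: matrix_mul_assoc 1)
  then have "rank A \<le> rank (A ** W ** X ** (W ** A ** W))"
    using rank_mul_le_left_field by metis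
  also have "\<dots> \<le> rank (W ** A ** W)"
    by (rule rank_mul_le_right_field)
  finally show "rank (W ** A ** W) = rank A"
    using order.trans[OF rank_mul_le_left_field rank_mul_le_right_field]
    by (rule order.antisym[rotated])
  have "E ** (W ** A) = W ** (A ** W ** X ** W ** A)"
    by (simp add: E_def matrix_mul_assoc)
  then have "E ** (W ** A) = W ** A"
    by (simp only: 1)
  then have "conj_transpose (W ** A) = conj_transpose (W ** A) ** E"
    using conj_transpose_mul[of E "W ** A"] by (simp add: 3)
  then have "conj_transpose (W ** A) = conj_transpose (W ** A) ** W ** A ** W ** X"
    by (simp add: E_def matrix_mul_assoc)
  then have "null_space X \<subseteq> null_space (conj_transpose (W ** A))"
    using null_space_matrix_mul by metis
  moreover have "X = X ** conj_transpose (W ** X) ** conj_transpose (W ** A)"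
  proof -
    have "X = X ** E"
      by (simp add: E_def matrix_mul_assoc 2)
    also have "E = conj_transpose ((W ** A) ** (W ** X))"
      using 3 by (simp add: E_def matrix_mul_assoc)
    finally show ?thesis
      by (simp only: conj_transpose_mul matrix_mul_assoc)
  qed
  then have "null_space (conj_transpose (W ** A)) \<subseteq> null_space X"
    using null_space_matrix_mul by metis
  ultimately show "null_space X = null_space (conj_transpose (W ** A))" ..
qed

lemma weighted_inverse_123_if_outer_inverse:
  fixes A X :: "complex^'n^'m" and W :: "complex^'m^'n"
  assumes rank: "rank (W ** A ** W) = rank A" and 2: "X ** W ** A ** W ** X = X"
    and null: "null_space X \<subseteq> null_space (conj_transpose (W ** A))"
  shows "X \<in> weighted_inverses_123 W A"
proof -
  define E where "E = W ** A ** W ** X"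
  obtain Z where Z: "conj_transpose (W ** A) = Z ** X"
    using null by (rule matrix_left_factor_if_null_space_subset)
  have "X ** E = X"
    by (simp add: E_def matrix_mul_assoc 2)
  then have adj: "conj_transpose (W ** A) ** E = conj_transpose (W ** A)"
    by (simp add: Z flip: matrix_mul_assoc)
  have "E = (W ** A) ** (W ** X)"
    by (simp add: E_def matrix_mul_assoc)
  then have "conj_transpose E = conj_transpose (W ** X) ** conj_transpose (W ** A)"
    by (simp only: conj_transpose_mul[of "W ** A"])
  then have "conj_transpose E ** E = conj_transpose E"
    by (metis adj matrix_mul_assoc)
  \<comment> \<open>E^* E is its own conjugate transpose, so E^* is too.\<close>
  then have herm: "conj_transpose E = E"
    by (metis conj_transpose_mul conj_transpose_conj_transpose)
  have WA: "E ** (W ** A) = W ** A"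
    using arg_cong[OF adj, of conj_transpose] by (simp add: conj_transpose_mul[of _ E] herm)
  have "rank A \<le> rank (W ** A)"
    unfolding rank[symmetric] by (rule rank_mul_le_left_field)
  then have "rank (W ** A) = rank A"
    by (simp add: rank_mul_le_right_field order.antisym)
  then obtain Y where Y: "A = Y ** (W ** A)"
    by (rule matrix_left_factor_if_rank_eq)
  \<comment> \<open>Writing the leftmost A as Y WA exposes the product E WA.\<close>
  have "A ** W ** X ** W ** A = (Y ** (W ** A)) ** W ** X ** W ** A"
    using Y by simp
  also have "\<dots> = Y ** (E ** (W ** A))"
    by (simp add: E_def matrix_mul_assoc)
  also have "\<dots> = A"
    using Y WA by simp
  finally show ?thesis
    using 2 herm by (simp add: weighted_inverses_123_def E_def)
qed

lemma outer_inverse_if_inner_inverse: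
  fixes A X :: "complex^'n^'m" and W :: "complex^'m^'n"
  assumes 1: "A ** W ** X ** W ** A = A" and rank: "rank X \<le> rank A"
  shows "X ** W ** A ** W ** X = X"
proof -
  have "rank A = rank (A ** W ** (X ** (W ** A)))"
    by (simp add: matrix_mul_assoc 1)
  also have "\<dots> \<le> rank (X ** (W ** A))"
    by (rule rank_mul_le_right_field)
  finally have "rank (X ** (W ** A)) = rank X"
    using rank rank_mul_le_left_field[of X "W ** A"] by linarith
  \<comment> \<open>Y expresses the columns of X through those of XWA. Substituting for the last X
    below makes the inner equation applicable.\<close>
  then obtain Y where Y: "X = X ** (W ** A) ** Y"
    by (rule matrix_right_factor_if_rank_eq)
  have "X ** W ** A ** W ** X = X ** W ** A ** W ** (X ** (W ** A) ** Y)"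
    using Y by simp
  also have "\<dots> = X ** W ** (A ** W ** X ** W ** A) ** Y"
    by (simp add: matrix_mul_assoc)
  also have "\<dots> = X"
    using Y by (simp add: 1 matrix_mul_assoc)
  finally show ?thesis .
qed

theorem theorem2p7:
  fixes A X :: "complex^'n^'m" and W :: "complex^'m^'n"
  shows
    "(X \<in> weighted_inverses_123 W A \<longleftrightarrow>
        rank (W ** A ** W) = rank A \<and> X ** W ** A ** W ** X = X
        \<and> null_space X = null_space (conj_transpose (W ** A)))
     \<and> (X \<in> weighted_inverses_123 W A \<longleftrightarrow>
        rank (W ** A ** W) = rank A \<and> A ** W ** X ** W ** A = A
        \<and> null_space X = null_space (conj_transpose (W ** A)))"
proof -
  let ?inner = "A ** W ** X ** W ** A = A" and ?outer = "X ** W ** A ** W ** X = X"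
  let ?null = "null_space X = null_space (conj_transpose (W ** A))"
  have "?outer" if "?inner" and null: ?null
  proof (rule outer_inverse_if_inner_inverse)
    \<comment> \<open>Equal null spaces give X the rank of (WA)^*, which is that of WA.\<close>
    show "rank X \<le> rank A"
      using rank_eq_if_null_space_eq[OF null] by (simp add: rank_mul_le_right_field)
  qed fact
  moreover have "?inner \<and> ?outer" if "X \<in> weighted_inverses_123 W A"
    using that unfolding weighted_inverses_123_def by blast
  \<comment> \<open>The facts collected here give (iii) to (ii), (ii) to (i), and (i) to
    both.\<close>
  moreover note weighted_inverse_123_imp[of X W A]
    weighted_inverse_123_if_outer_inverse[of W A X, OF _ _ equalityD1]
  ultimately show ?thesis by blast
qed

end
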